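(* Let $k\ge1$ be an integer and let $\varepsilon:=1$ if $k\equiv1,2\pmod 4$ and $\varepsilon:=-1$ if $k\equiv0,3\pmod4$. Then the following real-congruences hold: 1. $J_k(0)$ is real-congruent to $T_k(0)$. 2. $\Gamma_k\otimes[1]$ is real-congruent to $\widetilde\Gamma_k\otimes[\varepsilon]$, and $\Gamma_k\otimes[-1]$ is real-congruent to $\widetilde\Gamma_k\otimes[-\varepsilon]$. 3. If $a,b\in\mathbb{R}$, $a^2+b^2=1$ and $b>0$, then $\Gamma_k\otimes C(a,b)$ is real-congruent to $\widetilde\Gamma_k\otimes C(\varepsilon a,b)$. 4. If $a\in\mathbb{R}$ and $0<|a|<1$, then $H_{2k}(a)$ is real-congruent to $T_{2k}(a)$. 5. If $a,b\in\mathbb{R}$, $a^2+b^2<1$ and $b>0$, then $\widehat H_{4k}(a,b)$ is real-congruent to $\widehat T_{4k}(a,b)$.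
   Context: Two matrices $A,B\in\mathbb{R}^{n\times n}$ are real-congruent if there is an invertible $S\in\mathbb{R}^{n\times n}$ with $SAS^\top=B$. $\otimes$ is the Kronecker product. For integers $k\ge1$: $J_k(\mu)$ is the $k\times k$ upper triangular Jordan block with $\mu$ on the diagonal and $1$ on the superdiagonal. $\Gamma_k$ is the $k\times k$ matrix whose only nonzero entries are $(\Gamma_k)_{r,\,k+1-r}=(-1)^{k-r}$ for $1\le r\le k$ and $(\Gamma_k)_{r,\,k+2-r}=(-1)^{k-r}$ for $2\le r\le k$. So $\Gamma_1=1$, $\Gamma_2=\begin{bmatrix} 0 & -1 \\ 1 & 1 \end{bmatrix}$, $\Gamma_3=\begin{bmatrix} 0 & 0 & 1 \\ 0 & -1 & -1 \\ 1 & 1 & 0 \end{bmatrix}$. $H_{2k}(\mu)=\begin{bmatrix} 0 & I_k \\ J_k(\mu) & 0 \end{bmatrix}$. $C(a,b)=\begin{bmatrix} a & b \\ -b & a \end{bmatrix}$, and $C_{2k}(a,b)$ is the $2k\times 2k$ block upper bidiagonal matrix with $k$ diagonal $2\times2$ blocks equal to $C(a,b)$, blocks $I_2$ on the block superdiagonal and zeros elsewhere. $\widehat H_{4k}(a,b)=\begin{bmatrix} 0 & I_{2k} \\ C_{2k}(a,b) & 0 \end{bmatrix}$. $T_k(\mu)$ is the $k\times k$ tridiagonal matrix with zero diagonal, all superdiagonal entries equal to $1$ and all subdiagonal entries equal to $\mu$ ($T_1(\mu)=0$). $\widetilde\Gamma_k$ is the $k\times k$ tridiagonal matrix with $(1,1)$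 entry equal to $1$, all other diagonal entries $0$, all superdiagonal entries equal to $1$, and subdiagonal entries $(\widetilde\Gamma_k)_{i+1,i}=(-1)^i$, $i=1,\dots,k-1$ ($\widetilde\Gamma_1=1$). For an integer $m\ge1$, $\widehat T_{2m}(a,b)$ is the $2m\times2m$ block tridiagonal matrix consisting of $m\times m$ blocks of size $2\times2$, with zero diagonal blocks, all superdiagonal blocks equal to $I_2$, and all subdiagonal blocks equal to $C(a,b)$; $\widehat T_{4k}(a,b)$ is the case $m=2k$. *)

theory Defs
  imports "Jordan_Normal_Form.Jordan_Normal_Form"
begin

text \<open>
  Matrices are those of the Jordan Normal Form development, with rows and columns numbered from 0.
  A matrix entry $(r,c)$ in the usual 1-based numbering is therefore found at \<open>(r - 1, c - 1)\<close>.
\<close>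

definition real_congruent :: "real mat \<Rightarrow> real mat \<Rightarrow> bool" where
  "real_congruent A B \<longleftrightarrow>
     (\<exists>n. A \<in> carrier_mat n n \<and> B \<in> carrier_mat n n \<and>
        (\<exists>S \<in> carrier_mat n n. invertible_mat S \<and> S * A * transpose_mat S = B))"

definition kronecker :: "real mat \<Rightarrow> real mat \<Rightarrow> real mat" (infixl "\<otimes>\<^sub>K" 70) where
  "A \<otimes>\<^sub>K B = mat (dim_row A * dim_row B) (dim_col A * dim_col B)
     (\<lambda>(i, j). A $$ (i div dim_row B, j div dim_col B) * B $$ (i mod dim_row B, j mod dim_col B))"

definition mat1 :: "real \<Rightarrow> real mat" where
  "mat1 c = mat_of_rows_list 1 [[c]]"

text \<open>
  In 1-based indices the two nonzero antidiagonals are $c = k + 1 - r$ and $c = k + 2 - r$, i.e.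
  \<open>i + j + 1 = k\<close> and \<open>i + j = k\<close> for the 0-based \<open>i\<close>, \<open>j\<close>; the sign is $(-1)^{k-r}$ with \<open>r = Suc i\<close>.
  The restriction $2 \le r$ on the second one is implied by \<open>j < k\<close>.
\<close>

definition Gamma_mat :: "nat \<Rightarrow> real mat" where
  "Gamma_mat k = mat k k
     (\<lambda>(i, j). if i + j + 1 = k \<or> i + j = k then (- 1) ^ (k - Suc i) else 0)"

text \<open>\<open>H_mat k \<mu>\<close> is the $2k \times 2k$ matrix $H_{2k}(\mu)$.\<close>

definition H_mat :: "nat \<Rightarrow> real \<Rightarrow> real mat" where
  "H_mat k \<mu> = four_block_mat (0\<^sub>m k k) (1\<^sub>m k) (jordan_block k \<mu>) (0\<^sub>m k k)"

definition C_mat :: "real \<Rightarrow> real \<Rightarrow> real mat" where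
  "C_mat a b = mat_of_rows_list 2 [[a, b], [- b, a]]"

text \<open>The $2m \times 2m$ matrix whose $2 \times 2$ block in block position \<open>(p, q)\<close> is \<open>F p q\<close>.\<close>

definition block2_mat :: "nat \<Rightarrow> (nat \<Rightarrow> nat \<Rightarrow> real mat) \<Rightarrow> real mat" where
  "block2_mat m F = mat (2 * m) (2 * m) (\<lambda>(i, j). F (i div 2) (j div 2) $$ (i mod 2, j mod 2))"

text \<open>\<open>C_block_mat k a b\<close> is the $2k \times 2k$ matrix $C_{2k}(a,b)$.\<close>

definition C_block_mat :: "nat \<Rightarrow> real \<Rightarrow> real \<Rightarrow> real mat" where
  "C_block_mat k a b = block2_mat k
     (\<lambda>p q. if q = p then C_mat a b else if q = Suc p then 1\<^sub>m 2 else 0\<^sub>m 2 2)"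

text \<open>\<open>H_hat_mat k a b\<close> is the $4k \times 4k$ matrix $\widehat H_{4k}(a,b)$.\<close>

definition H_hat_mat :: "nat \<Rightarrow> real \<Rightarrow> real \<Rightarrow> real mat" where
  "H_hat_mat k a b = four_block_mat (0\<^sub>m (2 * k) (2 * k)) (1\<^sub>m (2 * k))
     (C_block_mat k a b) (0\<^sub>m (2 * k) (2 * k))"

definition T_mat :: "nat \<Rightarrow> real \<Rightarrow> real mat" where
  "T_mat k \<mu> = mat k k (\<lambda>(i, j). if j = Suc i then 1 else if i = Suc j then \<mu> else 0)"

text \<open>
  The subdiagonal entry $(i+1,i)$, $i \ge 1$, equal to $(-1)^i$, sits at the 0-based position
  \<open>(i, i - 1)\<close>, so the exponent is the 0-based row index.
\<close>

definition Gamma_tilde_mat :: "nat \<Rightarrow> real mat" where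
  "Gamma_tilde_mat k = mat k k
     (\<lambda>(i, j). if i = 0 \<and> j = 0 then 1 else if j = Suc i then 1
               else if i = Suc j then (- 1) ^ i else 0)"

text \<open>\<open>T_hat_mat m a b\<close> is the $2m \times 2m$ matrix $\widehat T_{2m}(a,b)$.\<close>

definition T_hat_mat :: "nat \<Rightarrow> real \<Rightarrow> real \<Rightarrow> real mat" where
  "T_hat_mat m a b = block2_mat m
     (\<lambda>p q. if q = Suc p then 1\<^sub>m 2 else if p = Suc q then C_mat a b else 0\<^sub>m 2 2)"

end

theory Submission
  imports Defs
begin

text \<open>
  The nonzero pattern of \<open>\<Gamma>\<^sub>k\<close> is a path with a loop at one end, so a permutation makes it
  tridiagonal, and a diagonal of signs normalises the superdiagonal; the sign \<open>\<epsilon>\<close> is the loop entry.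

  For \<open>H\<close>, let \<open>U\<close> be the nilpotent shift, \<open>J = \<mu> + U\<close> and \<open>R = 1 + cnj \<mu> * U\<close>. If \<open>|\<mu>| \<noteq> 1\<close>, then
  \<open>J * R\<inverse> - \<mu> = (1 - |\<mu>|\<^sup>2) * U * R\<inverse>\<close> is a single nilpotent block, so there is an invertible
  \<open>Y\<close> with \<open>Y * J = J * Y * R\<close>. The *-congruence by \<open>diag ((Y * R)\<^sup>*, Y\<inverse>)\<close> takes
  \<open>[0, 1; J, 0]\<close> to \<open>[0, R\<^sup>*; J, 0]\<close>, which is a permuted tridiagonal matrix. This works over any
  field with a conjugation: the real case is part 4, and part 5 is the complex case with each entry
  \<open>a + b\<i>\<close> replaced by the block \<open>C(a, b)\<close>, which turns conjugate transposes into transposes.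
\<close>

section \<open>Conjugate transposes and *-congruence over a field with conjugation\<close>

definition conj_transpose :: "'a :: conjugatable_field mat \<Rightarrow> 'a mat" where
  "conj_transpose A = map_mat conjugate (transpose_mat A)"

text \<open>Invertibility of \<open>S\<close> is recorded by an explicit right inverse, because such
  a witness passes directly through products, Kronecker products and realification.\<close>

definition star_congruent :: "'a :: conjugatable_field mat \<Rightarrow> 'a mat \<Rightarrow> bool" where
  "star_congruent A B \<longleftrightarrow>
     (\<exists>n S R. A \<in> carrier_mat n n \<and> B \<in> carrier_mat n n \<and> S \<in> carrier_mat n n \<and>
        R \<in> carrier_mat n n \<and> S * R = 1\<^sub>m n \<and> S * A * conj_transpose S = B)"

lemma star_congruentI:
  assumes "A \<in> carrier_mat n n" "S \<in> carrier_mat n n" "R \<in> carrier_mat n n"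
    and "S * R = 1\<^sub>m n" "S * A * conj_transpose S = B"
  shows "star_congruent A B"
proof -
  have "B \<in> carrier_mat n n"
    using assms by (auto simp: conj_transpose_def)
  then show ?thesis
    unfolding star_congruent_def using assms by blast
qed

lemma star_congruentE:
  assumes "star_congruent A B" "A \<in> carrier_mat n n"
  obtains S R where "B \<in> carrier_mat n n" "S \<in> carrier_mat n n" "R \<in> carrier_mat n n"
    "S * R = 1\<^sub>m n" "S * A * conj_transpose S = B"
proof -
  obtain m S R where *: "A \<in> carrier_mat m m" "B \<in> carrier_mat m m" "S \<in> carrier_mat m m"
    "R \<in> carrier_mat m m" "S * R = 1\<^sub>m m" "S * A * conj_transpose S = B"
    using assms(1) unfolding star_congruent_def by blast
  moreover have "m = n" using *(1) assms(2) by auto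
  ultimately show ?thesis using that by blast
qed

lemma conj_transpose_carrier [simp]:
  "conj_transpose A \<in> carrier_mat n m \<longleftrightarrow> A \<in> carrier_mat m n"
  by (simp add: conj_transpose_def)

lemma conj_transpose_dim [simp]:
  "dim_row (conj_transpose A) = dim_col A" "dim_col (conj_transpose A) = dim_row A"
  by (simp_all add: conj_transpose_def)

lemma conj_transpose_index [simp]:
  "i < dim_col A \<Longrightarrow> j < dim_row A \<Longrightarrow> conj_transpose A $$ (i, j) = conjugate (A $$ (j, i))"
  by (simp add: conj_transpose_def)

lemma conj_transpose_idem [simp]: "conj_transpose (conj_transpose A) = A"
  by (rule eq_matI) auto

lemma conj_transpose_real: "conj_transpose (A :: real mat) = transpose_mat A"
  by (rule eq_matI) auto

text \<open>By multiplicativity \<open>conjugate 1\<close> is a nonzero idempotent.\<close>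

lemma conjugate_one [simp]: "conjugate (1 :: 'a :: conjugatable_field) = 1"
proof -
  have "conjugate (1 :: 'a) * conjugate 1 = conjugate 1 * 1"
    using conjugate_dist_mul[of "1 :: 'a" 1] by simp
  moreover have "conjugate (1 :: 'a) \<noteq> 0" by simp
  ultimately show ?thesis by (metis mult_cancel_left)
qed

lemma conj_transpose_one [simp]: "conj_transpose (1\<^sub>m n) = 1\<^sub>m n"
  by (rule eq_matI) auto

lemma index_mult_mat_sum:
  assumes "A \<in> carrier_mat n m" "B \<in> carrier_mat m l" "i < n" "j < l"
  shows "(A * B) $$ (i, j) = (\<Sum>t<m. A $$ (i, t) * B $$ (t, j))"
  using assms by (auto simp: scalar_prod_def lessThan_atLeast0 intro!: sum.cong)

lemma conj_transpose_mult:
  assumes "A \<in> carrier_mat n m" "B \<in> carrier_mat m l"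
  shows "conj_transpose (A * B) = conj_transpose B * conj_transpose A"
proof (rule eq_matI)
  fix i j assume "i < dim_row (conj_transpose B * conj_transpose A)"
    "j < dim_col (conj_transpose B * conj_transpose A)"
  then have ij: "i < l" "j < n" using assms by auto
  have "conj_transpose (A * B) $$ (i, j) = conjugate (\<Sum>t<m. A $$ (j, t) * B $$ (t, i))"
    using assms ij by (simp add: index_mult_mat_sum del: index_mult_mat(1))
  also have "\<dots> = (\<Sum>t<m. conjugate (A $$ (j, t) * B $$ (t, i)))"
    by (simp add: sum_conjugate)
  also have "\<dots> = (\<Sum>t<m. conj_transpose B $$ (i, t) * conj_transpose A $$ (t, j))"
    using assms ij by (intro sum.cong) (auto simp: conjugate_dist_mul mult.commute)
  also have "\<dots> = (conj_transpose B * conj_transpose A) $$ (i, j)"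
    using assms ij by (subst index_mult_mat_sum[of _ l m _ n]) auto
  finally show "conj_transpose (A * B) $$ (i, j) = (conj_transpose B * conj_transpose A) $$ (i, j)" .
qed (use assms in auto)

lemma star_congruent_imp_real_congruent:
  assumes "star_congruent A B"
  shows "real_congruent A B"
proof -
  obtain n S R where *: "A \<in> carrier_mat n n" "B \<in> carrier_mat n n" "S \<in> carrier_mat n n"
    "R \<in> carrier_mat n n" "S * R = 1\<^sub>m n" "S * A * conj_transpose S = B"
    using assms unfolding star_congruent_def by blast
  \<comment> \<open>For square matrices over a field a right inverse is also a left inverse.\<close>
  have "R * S = 1\<^sub>m n" using mat_mult_left_right_inverse * by blast
  then have "invertible_mat S"
    using * unfolding invertible_mat_def inverts_mat_def square_mat.simps by auto
  then show ?thesis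
    unfolding real_congruent_def using * conj_transpose_real[of S] by metis
qed

lemma star_congruent_trans:
  assumes "star_congruent A B" "star_congruent B C"
  shows "star_congruent A C"
proof -
  obtain n S R where 1: "A \<in> carrier_mat n n" "B \<in> carrier_mat n n" "S \<in> carrier_mat n n"
    "R \<in> carrier_mat n n" "S * R = 1\<^sub>m n" "S * A * conj_transpose S = B"
    using assms(1) unfolding star_congruent_def by blast
  obtain S' R' where 2: "S' \<in> carrier_mat n n" "R' \<in> carrier_mat n n"
    "S' * R' = 1\<^sub>m n" "S' * B * conj_transpose S' = C"
    using star_congruentE[OF assms(2) 1(2)] by metis
  show ?thesis
  proof (rule star_congruentI)
    have "S' * S * (R * R') = S' * (S * R) * R'"
      using 1(3,4) 2(1,2) by (simp add: assoc_mult_mat[of _ n n _ n _ n])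
    also have "\<dots> = 1\<^sub>m n" unfolding 1(5) right_mult_one_mat[OF 2(1)] by (rule 2(3))
    finally show "S' * S * (R * R') = 1\<^sub>m n" .
    have "conj_transpose (S' * S) = conj_transpose S * conj_transpose S'"
      using 1 2 conj_transpose_mult by blast
    then have "S' * S * A * conj_transpose (S' * S) = S' * (S * A * conj_transpose S) * conj_transpose S'"
      using 1(1,3) 2(1) by (simp add: assoc_mult_mat[of _ n n _ n _ n])
    then show "S' * S * A * conj_transpose (S' * S) = C" unfolding 1(6) 2(4) .
  qed (use 1 2 in auto)
qed

lemma star_congruent_refl: "A \<in> carrier_mat n n \<Longrightarrow> star_congruent A A"
  by (rule star_congruentI[where S = "1\<^sub>m n" and R = "1\<^sub>m n"]) auto

text \<open>An injective self-map of \<open>{..<n}\<close> is a permutation, so the matrix with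
  \<open>d i\<close> in position \<open>(i, \<sigma> i)\<close> is invertible. All relabellings and
  sign changes of the development are instances.\<close>

lemma star_congruent_monomial:
  fixes A B :: "'a :: conjugatable_field mat"
  assumes A: "A \<in> carrier_mat n n" and B: "B \<in> carrier_mat n n"
    and inj: "inj_on \<sigma> {..<n}" and rng: "\<And>i. i < n \<Longrightarrow> \<sigma> i < n"
    and d: "\<And>i. i < n \<Longrightarrow> d i \<noteq> 0"
    and eq: "\<And>i j. i < n \<Longrightarrow> j < n \<Longrightarrow> B $$ (i, j) = d i * conjugate (d j) * A $$ (\<sigma> i, \<sigma> j)"
  shows "star_congruent A B"
proof -
  define S where "S = mat n n (\<lambda>(i, j). if j = \<sigma> i then d i else 0)"
  define R where "R = mat n n (\<lambda>(i, j). if i = \<sigma> j then inverse (d j) else 0)"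
  have S: "S \<in> carrier_mat n n" and R: "R \<in> carrier_mat n n"
    by (auto simp: S_def R_def)
  have SM: "(S * M) $$ (i, j) = d i * M $$ (\<sigma> i, j)"
    if "i < n" "j < n" "M \<in> carrier_mat n n" for M i j
  proof -
    have "(S * M) $$ (i, j) = (\<Sum>t<n. S $$ (i, t) * M $$ (t, j))"
      by (rule index_mult_mat_sum[OF S that(3,1,2)])
    also have "\<dots> = (\<Sum>t<n. if t = \<sigma> i then d i * M $$ (\<sigma> i, j) else 0)"
      by (rule sum.cong) (use that in \<open>auto simp: S_def\<close>)
    finally show ?thesis using rng[OF that(1)] by simp
  qed
  show ?thesis
  proof (rule star_congruentI)
    show "S * R = 1\<^sub>m n"
    proof (rule eq_matI)
      fix i j assume "i < dim_row (1\<^sub>m n :: 'a mat)" "j < dim_col (1\<^sub>m n :: 'a mat)"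
      then have ij: "i < n" "j < n" by auto
      then show "(S * R) $$ (i, j) = 1\<^sub>m n $$ (i, j)"
        using SM[OF ij R] rng[of i] inj_on_eq_iff[OF inj, of i j] d[of j]
        by (auto simp: R_def simp del: index_mult_mat(1))
    qed (use S R in auto)
    show "S * A * conj_transpose S = B"
    proof (rule eq_matI)
      fix i j assume "i < dim_row B" "j < dim_col B"
      then have ij: "i < n" "j < n" using B by auto
      have SA: "S * A \<in> carrier_mat n n" using S A by simp
      have "(S * A * conj_transpose S) $$ (i, j)
          = (\<Sum>t<n. (S * A) $$ (i, t) * conj_transpose S $$ (t, j))"
        by (rule index_mult_mat_sum[OF SA _ ij]) (use S in simp)
      also have "\<dots>
          = (\<Sum>t<n. if t = \<sigma> j then d i * A $$ (\<sigma> i, \<sigma> j) * conjugate (d j) else 0)"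
      proof (rule sum.cong)
        fix t assume "t \<in> {..<n}"
        moreover from this have "conj_transpose S $$ (t, j) = (if t = \<sigma> j then conjugate (d j) else 0)"
          using ij by (simp add: S_def)
        ultimately show "(S * A) $$ (i, t) * conj_transpose S $$ (t, j)
            = (if t = \<sigma> j then d i * A $$ (\<sigma> i, \<sigma> j) * conjugate (d j) else 0)"
          using SM[OF ij(1) _ A, of t] by simp
      qed simp
      also have "\<dots> = B $$ (i, j)"
        using rng[of j] ij eq by simp
      finally show "(S * A * conj_transpose S) $$ (i, j) = B $$ (i, j)" .
    qed (use S A B in auto)
  qed (use S R A in auto)
qed

section \<open>Kronecker products\<close>

text \<open>Each index is written as \<open>t = p * m + r\<close>. This splits the inner sum of a
  matrix product blockwise, both for Kronecker products and for realified complex matrices.\<close>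

lemma sum_div_mod:
  fixes f :: "nat \<Rightarrow> nat \<Rightarrow> 'a :: comm_monoid_add"
  shows "(\<Sum>t<n * m. f (t div m) (t mod m)) = (\<Sum>p<n. \<Sum>r<m. f p r)"
proof -
  have "(\<Sum>t<n * m. f (t div m) (t mod m))
      = (\<Sum>p<n. \<Sum>t\<in>{p * m..<p * m + m}. f (t div m) (t mod m))"
    by (rule sum.nat_group[symmetric])
  also have "\<dots> = (\<Sum>p<n. \<Sum>r<m. f p r)"
  proof (rule sum.cong)
    fix p
    have "(\<Sum>t\<in>{p * m..<p * m + m}. f (t div m) (t mod m))
        = (\<Sum>r\<in>{0..<m}. f ((r + p * m) div m) ((r + p * m) mod m))"
      using sum.shift_bounds_nat_ivl[of "\<lambda>t. f (t div m) (t mod m)" 0 "p * m" m]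
      by (simp add: add.commute)
    also have "\<dots> = (\<Sum>r<m. f p r)"
      by (rule sum.cong) auto
    finally show "(\<Sum>t\<in>{p * m..<p * m + m}. f (t div m) (t mod m)) = (\<Sum>r<m. f p r)" .
  qed simp
  finally show ?thesis .
qed

lemma div_mod_less:
  fixes i n m :: nat
  assumes "i < n * m"
  shows "i div m < n" "i mod m < m"
proof -
  show "i div m < n" using assms by (simp add: less_mult_imp_div_less)
  show "i mod m < m" using assms by (cases m) auto
qed

lemma kronecker_carrier [simp]:
  "A \<in> carrier_mat n n' \<Longrightarrow> B \<in> carrier_mat m m' \<Longrightarrow> A \<otimes>\<^sub>K B \<in> carrier_mat (n * m) (n' * m')"
  by (auto simp: kronecker_def)

lemma kronecker_index:
  assumes "A \<in> carrier_mat n n'" "B \<in> carrier_mat m m'" "i < n * m" "j < n' * m'"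
  shows "(A \<otimes>\<^sub>K B) $$ (i, j) = A $$ (i div m, j div m') * B $$ (i mod m, j mod m')"
  using assms by (auto simp: kronecker_def)

text \<open>The mixed-product property: the double sum over \<open>(p, r)\<close> factors into the
  two inner sums.\<close>

lemma kronecker_mult:
  assumes A: "A \<in> carrier_mat n n'" "A' \<in> carrier_mat n' n''"
    and B: "B \<in> carrier_mat m m'" "B' \<in> carrier_mat m' m''"
  shows "(A \<otimes>\<^sub>K B) * (A' \<otimes>\<^sub>K B') = (A * A') \<otimes>\<^sub>K (B * B')"
proof (rule eq_matI)
  have C: "A * A' \<in> carrier_mat n n''" "B * B' \<in> carrier_mat m m''" using assms by auto
  fix i j assume "i < dim_row ((A * A') \<otimes>\<^sub>K (B * B'))" "j < dim_col ((A * A') \<otimes>\<^sub>K (B * B'))"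
  then have ij: "i < n * m" "j < n'' * m''" using assms by (auto simp: kronecker_def)
  note lt = div_mod_less[OF ij(1)] div_mod_less[OF ij(2)]
  have "((A \<otimes>\<^sub>K B) * (A' \<otimes>\<^sub>K B')) $$ (i, j)
      = (\<Sum>t<n' * m'. (A \<otimes>\<^sub>K B) $$ (i, t) * (A' \<otimes>\<^sub>K B') $$ (t, j))"
    by (rule index_mult_mat_sum[of _ "n * m" _ _ "n'' * m''"]) (use assms ij in auto)
  also have "\<dots> = (\<Sum>t<n' * m'. (A $$ (i div m, t div m') * B $$ (i mod m, t mod m'))
      * (A' $$ (t div m', j div m'') * B' $$ (t mod m', j mod m'')))"
    using ij kronecker_index[OF A(1) B(1)] kronecker_index[OF A(2) B(2)]
    by (intro sum.cong) auto
  also have "\<dots> = (\<Sum>p<n'. \<Sum>r<m'. (A $$ (i div m, p) * B $$ (i mod m, r))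
      * (A' $$ (p, j div m'') * B' $$ (r, j mod m'')))"
    by (rule sum_div_mod)
  also have "\<dots> = (A * A') $$ (i div m, j div m'') * (B * B') $$ (i mod m, j mod m'')"
    unfolding index_mult_mat_sum[OF A lt(1,3)] index_mult_mat_sum[OF B lt(2,4)] sum_product
    by (simp add: ac_simps)
  also have "\<dots> = ((A * A') \<otimes>\<^sub>K (B * B')) $$ (i, j)"
    using kronecker_index[OF C ij] by simp
  finally show "((A \<otimes>\<^sub>K B) * (A' \<otimes>\<^sub>K B')) $$ (i, j) = ((A * A') \<otimes>\<^sub>K (B * B')) $$ (i, j)" .
qed (use assms in \<open>auto simp: kronecker_def\<close>)

lemma kronecker_one: "1\<^sub>m n \<otimes>\<^sub>K 1\<^sub>m m = 1\<^sub>m (n * m)"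
proof (rule eq_matI)
  fix i j assume "i < dim_row (1\<^sub>m (n * m) :: real mat)" "j < dim_col (1\<^sub>m (n * m) :: real mat)"
  then have ij: "i < n * m" "j < n * m" by auto
  have "i = j \<longleftrightarrow> i div m = j div m \<and> i mod m = j mod m"
    by (metis div_mult_mod_eq)
  then show "(1\<^sub>m n \<otimes>\<^sub>K 1\<^sub>m m) $$ (i, j) = 1\<^sub>m (n * m) $$ (i, j)"
    using ij div_mod_less[OF ij(1)] div_mod_less[OF ij(2)]
    by (auto simp: kronecker_index[of _ n n _ m m])
qed (auto simp: kronecker_def)

lemma kronecker_conj_transpose:
  "conj_transpose (A \<otimes>\<^sub>K B) = conj_transpose A \<otimes>\<^sub>K conj_transpose B"
proof (rule eq_matI)
  fix i j assume "i < dim_row (conj_transpose A \<otimes>\<^sub>K conj_transpose B)"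
    "j < dim_col (conj_transpose A \<otimes>\<^sub>K conj_transpose B)"
  then have ij: "i < dim_col A * dim_col B" "j < dim_row A * dim_row B"
    by (auto simp: kronecker_def)
  then show "conj_transpose (A \<otimes>\<^sub>K B) $$ (i, j) = (conj_transpose A \<otimes>\<^sub>K conj_transpose B) $$ (i, j)"
    using div_mod_less[OF ij(1)] div_mod_less[OF ij(2)] by (simp add: kronecker_def)
qed (auto simp: kronecker_def)

text \<open>By the mixed-product property the Kronecker product of the two congruence matrices does
  the job.\<close>

lemma star_congruent_kronecker:
  assumes "star_congruent A B" "star_congruent C D"
  shows "star_congruent (A \<otimes>\<^sub>K C) (B \<otimes>\<^sub>K D)"
proof -
  obtain n S R where 1: "A \<in> carrier_mat n n" "B \<in> carrier_mat n n" "S \<in> carrier_mat n n"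
    "R \<in> carrier_mat n n" "S * R = 1\<^sub>m n" "S * A * conj_transpose S = B"
    using assms(1) unfolding star_congruent_def by blast
  obtain m S' R' where 2: "C \<in> carrier_mat m m" "D \<in> carrier_mat m m" "S' \<in> carrier_mat m m"
    "R' \<in> carrier_mat m m" "S' * R' = 1\<^sub>m m" "S' * C * conj_transpose S' = D"
    using assms(2) unfolding star_congruent_def by blast
  show ?thesis
  proof (rule star_congruentI)
    show "(S \<otimes>\<^sub>K S') * (R \<otimes>\<^sub>K R') = 1\<^sub>m (n * m)"
      using 1 2 by (simp add: kronecker_mult[of _ n n _ n _ m m _ m] kronecker_one)
    have "S * A \<in> carrier_mat n n" "S' * C \<in> carrier_mat m m" using 1 2 by auto
    then show "(S \<otimes>\<^sub>K S') * (A \<otimes>\<^sub>K C) * conj_transpose (S \<otimes>\<^sub>K S') = B \<otimes>\<^sub>K D"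
      using 1 2 by (simp add: kronecker_mult[of _ n n _ n _ m m _ m] kronecker_conj_transpose)
  qed (use 1 2 in auto)
qed

section \<open>Tridiagonal form of \<open>Gamma_mat\<close>\<close>

text \<open>
  Starting from the free end, the path underlying \<^const>\<open>Gamma_mat\<close> visits
  \<open>0, k - 1, 1, k - 2, \<dots>\<close>; in \<^const>\<open>Gamma_tilde_mat\<close> the loop comes first, so the path is
  traversed backwards.
\<close>

definition zigzag :: "nat \<Rightarrow> nat \<Rightarrow> nat" where
  "zigzag k p = (let q = k - Suc p in if even q then q div 2 else k - Suc q div 2)"

text \<open>Stated without subtraction and division, so that the facts about the path reduce to
  linear arithmetic and parity.\<close>

lemma zigzag_cases:
  assumes "p < k"
  obtains (even) u where "Suc p + 2 * u = k" "zigzag k p = u"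
    | (odd) u where "Suc (Suc p) + 2 * u = k" "zigzag k p + Suc u = k"
proof (cases "even (k - Suc p)")
  case True
  then obtain u where "k - Suc p = 2 * u" by blast
  then show ?thesis using assms True even[of u] by (auto simp: zigzag_def Let_def)
next
  case False
  then obtain u where "k - Suc p = 2 * u + 1" by (blast elim: oddE)
  then show ?thesis using assms False odd[of u] by (auto simp: zigzag_def Let_def)
qed

lemma zigzag_less: "p < k \<Longrightarrow> zigzag k p < k"
  by (erule zigzag_cases) auto

lemma zigzag_inj: "inj_on (zigzag k) {..<k}"
  by (rule inj_onI) (auto elim!: zigzag_cases)

text \<open>At the places \<open>2 * u\<close>, \<open>2 * u + 1\<close>, \<open>2 * u + 2\<close>,
  counted from the free end, the path visits \<open>u\<close>, \<open>k - 1 - u\<close>,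
  \<open>u + 1\<close>. Consecutive sums therefore alternate between \<open>k - 1\<close> and
  \<open>k\<close>, which are the two antidiagonals; the last vertex added to itself gives the
  loop.\<close>

lemma zigzag_adjacent:
  assumes "p < k" "p' < k"
  shows "zigzag k p + zigzag k p' + 1 = k \<or> zigzag k p + zigzag k p' = k \<longleftrightarrow>
    p' = Suc p \<or> p = Suc p' \<or> p = 0 \<and> p' = 0"
  using assms(1)
proof (cases p rule: zigzag_cases)
  case (even u)
  from assms(2) show ?thesis
    by (cases p' rule: zigzag_cases) (use even in \<open>auto; presburger\<close>)+
next
  case (odd u)
  from assms(2) show ?thesis
    by (cases p' rule: zigzag_cases) (use odd in \<open>auto; presburger\<close>)+
qed


text \<open>All nonzero entries in a row of \<open>Gamma_mat\<close> have the same sign; this is the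
  one for the row visited at place \<open>p\<close>.\<close>

definition zigzag_sign :: "nat \<Rightarrow> nat \<Rightarrow> real" where
  "zigzag_sign k p = (- 1) ^ (k - Suc (zigzag k p))"

text \<open>The product of two opposite entries is invariant under a diagonal congruence by signs,
  so it has to agree with the corresponding product in \<open>Gamma_tilde_mat\<close>.\<close>

lemma zigzag_sign_Suc:
  assumes "Suc p < k"
  shows "zigzag_sign k p * zigzag_sign k (Suc p) = (- 1) ^ Suc p"
proof -
  have "even ((k - Suc (zigzag k p)) + (k - Suc (zigzag k (Suc p)))) \<longleftrightarrow> even (Suc p)"
    using Suc_lessD[OF assms]
  proof (cases p rule: zigzag_cases)
    case (even u)
    from assms show ?thesis
      by (cases "Suc p" rule: zigzag_cases) (use even in \<open>auto; presburger\<close>)+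
  next
    case (odd u)
    from assms show ?thesis
      by (cases "Suc p" rule: zigzag_cases) (use odd in \<open>auto; presburger\<close>)+
  qed
  then show ?thesis
    unfolding zigzag_sign_def power_add[symmetric] by (simp only: minus_one_power_iff)
qed

text \<open>The sign of the loop entry has as exponent the integer part of
  \<open>(k - 1) / 2\<close>; hence the dependence on \<open>k mod 4\<close>.\<close>

lemma zigzag_sign_0:
  assumes "k \<ge> 1"
  shows "zigzag_sign k 0 = (if k mod 4 = 1 \<or> k mod 4 = 2 then 1 else - 1)"
proof -
  have "0 < k" using assms by simp
  then have "even (k - Suc (zigzag k 0)) \<longleftrightarrow> k mod 4 = 1 \<or> k mod 4 = 2"
  proof (cases "0 :: nat" rule: zigzag_cases)
    case (even u)
    then have *: "k - Suc (zigzag k 0) = u" "k = 2 * u + 1" by auto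
    show ?thesis unfolding *(1) unfolding *(2) by presburger
  next
    case (odd u)
    then have *: "k - Suc (zigzag k 0) = u" "k = 2 * u + 2" by auto
    show ?thesis unfolding *(1) unfolding *(2) by presburger
  qed
  then show ?thesis
    unfolding zigzag_sign_def minus_one_power_iff by simp
qed

lemma Gamma_mat_zigzag:
  assumes "p < k" "p' < k"
  shows "Gamma_mat k $$ (zigzag k p, zigzag k p')
    = (if p' = Suc p \<or> p = Suc p' \<or> p = 0 \<and> p' = 0 then zigzag_sign k p else 0)"
  using zigzag_adjacent[OF assms] zigzag_less[OF assms(1)] zigzag_less[OF assms(2)]
  by (simp add: Gamma_mat_def zigzag_sign_def)

text \<open>Sign changes cannot alter the loop entry \<open>\<epsilon>\<close>, whereas
  \<open>Gamma_tilde_mat\<close> has loop entry \<open>1\<close>; hence the scalar in front.\<close>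

lemma Gamma_star_congruent:
  assumes "k \<ge> 1" and \<epsilon>: "\<epsilon> = (if k mod 4 = 1 \<or> k mod 4 = 2 then 1 else - 1)"
  shows "star_congruent (Gamma_mat k) (\<epsilon> \<cdot>\<^sub>m Gamma_tilde_mat k)"
proof -
  \<comment> \<open>The recursion solves
    \<open>d p * d (Suc p) * zigzag_sign k p = \<epsilon>\<close>, which makes every superdiagonal
    entry equal to \<open>\<epsilon>\<close>. The subdiagonal is then determined by
    \<open>zigzag_sign_Suc\<close>.\<close>
  define d where "d = rec_nat 1 (\<lambda>p x. \<epsilon> * x * zigzag_sign k p)"
  have d_simps [simp]: "d 0 = 1" "d (Suc p) = \<epsilon> * d p * zigzag_sign k p" for p
    by (simp_all add: d_def)
  have \<epsilon>2: "\<epsilon> * \<epsilon> = 1" using \<epsilon> by simp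
  have s2: "zigzag_sign k p * zigzag_sign k p = 1" for p
    by (simp add: zigzag_sign_def flip: power_mult_distrib)
  have d2: "d p * d p = 1" for p
  proof (induction p)
    case (Suc p)
    have "d (Suc p) * d (Suc p) = (\<epsilon> * \<epsilon>) * (d p * d p) * (zigzag_sign k p * zigzag_sign k p)"
      by simp
    then show ?case by (simp only: \<epsilon>2 s2 Suc mult_1)
  qed simp
  show ?thesis
  proof (rule star_congruent_monomial[where \<sigma> = "zigzag k" and d = d and n = k])
    show "d i \<noteq> 0" for i using d2[of i] by auto
    fix i j assume ij: "i < k" "j < k"
    have super: "d p * d (Suc p) * zigzag_sign k p = \<epsilon>" for p
    proof -
      have "d p * d (Suc p) * zigzag_sign k p
          = \<epsilon> * (d p * d p) * (zigzag_sign k p * zigzag_sign k p)" by simp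
      then show ?thesis by (simp only: d2 s2 mult_1_right)
    qed
    have sub: "d (Suc p) * d p * zigzag_sign k (Suc p) = \<epsilon> * (- 1) ^ Suc p" if "Suc p < k" for p
    proof -
      have "d (Suc p) * d p * zigzag_sign k (Suc p)
          = \<epsilon> * (d p * d p) * (zigzag_sign k p * zigzag_sign k (Suc p))" by simp
      then show ?thesis by (simp only: d2 zigzag_sign_Suc[OF that] mult_1_right)
    qed
    consider "j = Suc i" | "i = Suc j" | "i = 0 \<and> j = 0"
      | "\<not> (j = Suc i \<or> i = Suc j \<or> i = 0 \<and> j = 0)" by blast
    then show "(\<epsilon> \<cdot>\<^sub>m Gamma_tilde_mat k) $$ (i, j)
        = d i * conjugate (d j) * Gamma_mat k $$ (zigzag k i, zigzag k j)"
    proof cases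
      case 1
      then show ?thesis
        using ij super[of i] by (simp add: Gamma_mat_zigzag Gamma_tilde_mat_def del: d_simps)
    next
      case 2
      then show ?thesis
        using ij sub[of j] by (simp add: Gamma_mat_zigzag Gamma_tilde_mat_def del: d_simps)
    next
      case 3
      then show ?thesis
        using ij zigzag_sign_0[OF assms(1)] \<epsilon> by (simp add: Gamma_mat_zigzag Gamma_tilde_mat_def)
    next
      case 4
      then show ?thesis
        using ij by (auto simp: Gamma_mat_zigzag Gamma_tilde_mat_def)
    qed
  qed (auto simp: Gamma_mat_def Gamma_tilde_mat_def zigzag_inj zigzag_less)
qed

lemma smult_kronecker:
  "(c \<cdot>\<^sub>m A) \<otimes>\<^sub>K B = A \<otimes>\<^sub>K (c \<cdot>\<^sub>m B)"
proof (rule eq_matI)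
  fix i j assume "i < dim_row (A \<otimes>\<^sub>K (c \<cdot>\<^sub>m B))" "j < dim_col (A \<otimes>\<^sub>K (c \<cdot>\<^sub>m B))"
  then have ij: "i < dim_row A * dim_row B" "j < dim_col A * dim_col B"
    by (auto simp: kronecker_def)
  then show "((c \<cdot>\<^sub>m A) \<otimes>\<^sub>K B) $$ (i, j) = (A \<otimes>\<^sub>K (c \<cdot>\<^sub>m B)) $$ (i, j)"
    using div_mod_less[OF ij(1)] div_mod_less[OF ij(2)] by (simp add: kronecker_def)
qed (auto simp: kronecker_def)

text \<open>The scalar \<open>\<epsilon>\<close> produced by the first factor is moved to the second
  one, where it cancels because \<open>\<epsilon> * \<epsilon> = 1\<close>.\<close>

lemma Gamma_kronecker:
  assumes "k \<ge> 1" "\<epsilon> = (if k mod 4 = 1 \<or> k mod 4 = 2 then 1 else - 1)"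
    and "star_congruent C (\<epsilon> \<cdot>\<^sub>m D)"
  shows "real_congruent (Gamma_mat k \<otimes>\<^sub>K C) (Gamma_tilde_mat k \<otimes>\<^sub>K D)"
proof -
  have "\<epsilon> \<cdot>\<^sub>m (\<epsilon> \<cdot>\<^sub>m D) = D"
    using assms(2) by (intro eq_matI) auto
  then have "(\<epsilon> \<cdot>\<^sub>m Gamma_tilde_mat k) \<otimes>\<^sub>K (\<epsilon> \<cdot>\<^sub>m D) = Gamma_tilde_mat k \<otimes>\<^sub>K D"
    by (simp add: smult_kronecker)
  then show ?thesis
    using star_congruent_kronecker[OF Gamma_star_congruent[OF assms(1,2)] assms(3)]
    by (metis star_congruent_imp_real_congruent)
qed

lemma C_mat_carrier [simp]: "C_mat a b \<in> carrier_mat 2 2"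
  by (auto simp: C_mat_def mat_of_rows_list_def)

lemma C_mat_dim [simp]: "dim_row (C_mat a b) = 2" "dim_col (C_mat a b) = 2"
  by (auto simp: C_mat_def mat_of_rows_list_def)

lemma C_mat_index:
  "r < 2 \<Longrightarrow> s < 2 \<Longrightarrow> C_mat a b $$ (r, s) = (if r = s then a else if r = 0 then b else - b)"
  by (auto simp: C_mat_def mat_of_rows_list_def less_2_cases_iff)

text \<open>Congruence by \<open>diag (1, \<epsilon>)\<close> turns \<open>C(a, b)\<close> into
  \<open>C(a, \<epsilon> * b)\<close>, and this equals
  \<open>\<epsilon> * C(\<epsilon> * a, b)\<close>.\<close>

lemma C_mat_star_congruent:
  assumes "\<epsilon> = 1 \<or> \<epsilon> = - 1"
  shows "star_congruent (C_mat a b) (\<epsilon> \<cdot>\<^sub>m C_mat (\<epsilon> * a) b)"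
proof (rule star_congruent_monomial[where \<sigma> = id and d = "\<lambda>i. \<epsilon> ^ i" and n = 2])
  fix i j :: nat assume "i < 2" "j < 2"
  then show "(\<epsilon> \<cdot>\<^sub>m C_mat (\<epsilon> * a) b) $$ (i, j)
      = \<epsilon> ^ i * conjugate (\<epsilon> ^ j) * C_mat a b $$ (id i, id j)"
    using assms by (auto simp: C_mat_index less_2_cases_iff)
qed (use assms in auto)

section \<open>Intertwining a Jordan block with a bidiagonal perturbation\<close>

text \<open>
  The rows of the matrix conjugating \<open>(\<mu> + U) * (1 + m * U)\<inverse>\<close> to \<open>\<mu> + U\<close>, where \<open>U\<close> is the
  nilpotent shift and \<open>c = \<mu> * m\<close>: row \<open>i\<close> lists the coefficients of the power series
  \<open>((1 - c) * x / (1 + m * x)) ^ i\<close>.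
\<close>

fun shift_coeff :: "'a :: comm_ring_1 \<Rightarrow> 'a \<Rightarrow> nat \<Rightarrow> nat \<Rightarrow> 'a" where
  "shift_coeff c m 0 0 = 1"
| "shift_coeff c m 0 (Suc j) = 0"
| "shift_coeff c m (Suc i) 0 = 0"
| "shift_coeff c m (Suc i) (Suc j) = (1 - c) * shift_coeff c m i j - m * shift_coeff c m (Suc i) j"

lemma shift_coeff_lower: "j < i \<Longrightarrow> shift_coeff c m i j = 0"
  by (induction c m i j rule: shift_coeff.induct) auto

text \<open>The \<open>i\<close>-th power series has leading term \<open>((1 - c) * x) ^ i\<close>;
  over a field, \<open>c \<noteq> 1\<close> thus makes the triangular matrix invertible.\<close>

lemma shift_coeff_diag: "shift_coeff c m i i = (1 - c) ^ i"
  by (induction i) (auto simp: shift_coeff_lower)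

definition shift_mat :: "'a :: comm_ring_1 \<Rightarrow> 'a \<Rightarrow> nat \<Rightarrow> 'a mat" where
  "shift_mat c m n = mat n n (\<lambda>(i, j). shift_coeff c m i j)"

text \<open>This is \<open>a + b * U\<close> with the nilpotent shift \<open>U\<close>, the common
  form of \<open>J\<close> and \<open>R\<close>.\<close>

definition bidiag_mat :: "nat \<Rightarrow> 'a :: comm_ring_1 \<Rightarrow> 'a \<Rightarrow> 'a mat" where
  "bidiag_mat n a b = mat n n (\<lambda>(i, j). if i = j then a else if j = Suc i then b else 0)"

lemma bidiag_mat_carrier [simp]: "bidiag_mat n a b \<in> carrier_mat n n"
  by (simp add: bidiag_mat_def)

lemma shift_mat_carrier [simp]: "shift_mat c m n \<in> carrier_mat n n"
  by (simp add: shift_mat_def)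

lemma jordan_block_bidiag: "jordan_block n \<mu> = bidiag_mat n \<mu> 1"
  by (rule eq_matI) (auto simp: bidiag_mat_def)

lemma mult_bidiag_index:
  assumes "M \<in> carrier_mat n n" "i < n" "j < n"
  shows "(M * bidiag_mat n a b) $$ (i, j)
    = M $$ (i, j) * a + (if j = 0 then 0 else M $$ (i, j - 1) * b)"
proof -
  have "(M * bidiag_mat n a b) $$ (i, j)
      = (\<Sum>t<n. M $$ (i, t) * bidiag_mat n a b $$ (t, j))"
    using assms by (intro index_mult_mat_sum) auto
  \<comment> \<open>For \<open>j = 0\<close> the truncated \<open>j - 1\<close> is again
    \<open>0\<close>; the inner conditional discards that spurious term.\<close>
  also have "\<dots> = (\<Sum>t<n. (if t = j then M $$ (i, j) * a else 0)
      + (if t = j - 1 then (if j = 0 then 0 else M $$ (i, j - 1) * b) else 0))"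
    using assms by (intro sum.cong) (auto simp: bidiag_mat_def)
  also have "\<dots> = M $$ (i, j) * a + (if j = 0 then 0 else M $$ (i, j - 1) * b)"
    using assms by (simp add: sum.distrib)
  finally show ?thesis .
qed

lemma bidiag_mult_index:
  assumes "M \<in> carrier_mat n n" "i < n" "j < n"
  shows "(bidiag_mat n a b * M) $$ (i, j)
    = a * M $$ (i, j) + (if Suc i < n then b * M $$ (Suc i, j) else 0)"
proof -
  have "(bidiag_mat n a b * M) $$ (i, j)
      = (\<Sum>t<n. bidiag_mat n a b $$ (i, t) * M $$ (t, j))"
    using assms by (intro index_mult_mat_sum) auto
  also have "\<dots> = (\<Sum>t<n. (if t = i then a * M $$ (i, j) else 0)
      + (if t = Suc i then b * M $$ (Suc i, j) else 0))"
    using assms by (intro sum.cong) (auto simp: bidiag_mat_def)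
  also have "\<dots> = a * M $$ (i, j) + (if Suc i < n then b * M $$ (Suc i, j) else 0)"
    using assms by (simp add: sum.distrib)
  finally show ?thesis .
qed

text \<open>With \<open>f = (1 - c) * x / (1 + m * x)\<close> and \<open>c = \<mu> * m\<close>, one
  has \<open>(\<mu> + x) / (1 + m * x) = \<mu> + f\<close>. Multiplying row \<open>i\<close>, which
  is \<open>f ^ i\<close>, by \<open>f\<close> yields row \<open>i + 1\<close>. Clearing the
  denominator leaves the recursion of \<open>shift_coeff\<close>.\<close>

lemma shift_mat_intertwines:
  "shift_mat (\<mu> * m) m n * bidiag_mat n \<mu> 1
    = bidiag_mat n \<mu> 1 * (shift_mat (\<mu> * m) m n * bidiag_mat n 1 m)"
proof (rule eq_matI)
  let ?Y = "shift_mat (\<mu> * m) m n" and ?y = "shift_coeff (\<mu> * m) m"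
  fix i j assume "i < dim_row (bidiag_mat n \<mu> 1 * (?Y * bidiag_mat n 1 m))"
    "j < dim_col (bidiag_mat n \<mu> 1 * (?Y * bidiag_mat n 1 m))"
  then have ij: "i < n" "j < n" by (auto simp: bidiag_mat_def shift_mat_def)
  have YR: "(?Y * bidiag_mat n 1 m) $$ (p, j)
      = ?y p j + (if j = 0 then 0 else ?y p (j - 1) * m)" if "p < n" for p
    unfolding mult_bidiag_index[OF shift_mat_carrier that ij(2)]
    using that ij by (auto simp: shift_mat_def)
  have YR_Suc: "(if Suc i < n then (?Y * bidiag_mat n 1 m) $$ (Suc i, j) else 0)
      = (if j = 0 then 0 else (1 - \<mu> * m) * ?y i (j - 1))"
  proof (cases "Suc i < n")
    case True
    then show ?thesis using YR[OF True] by (cases j) (auto simp: algebra_simps)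
  next
    case False
    \<comment> \<open>Row \<open>i\<close> is the last one, so \<open>j - 1\<close> lies strictly
      below the diagonal and the right-hand side vanishes as well.\<close>
    then have "j \<noteq> 0 \<Longrightarrow> j - 1 < i" using ij by auto
    then show ?thesis using False by (simp add: shift_coeff_lower)
  qed
  have "(bidiag_mat n \<mu> 1 * (?Y * bidiag_mat n 1 m)) $$ (i, j)
      = \<mu> * (?Y * bidiag_mat n 1 m) $$ (i, j)
        + (if Suc i < n then (?Y * bidiag_mat n 1 m) $$ (Suc i, j) else 0)"
    by (simp only: bidiag_mult_index[OF mult_carrier_mat[OF shift_mat_carrier bidiag_mat_carrier] ij]
        mult_1)
  also have "\<dots> = (?Y * bidiag_mat n \<mu> 1) $$ (i, j)"
    unfolding YR_Suc YR[OF ij(1)] mult_bidiag_index[OF shift_mat_carrier ij]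
    using ij by (auto simp: shift_mat_def algebra_simps)
  finally show "(?Y * bidiag_mat n \<mu> 1) $$ (i, j)
    = (bidiag_mat n \<mu> 1 * (?Y * bidiag_mat n 1 m)) $$ (i, j)" ..
qed (auto simp: bidiag_mat_def shift_mat_def)

lemma upper_triangular_invertible:
  fixes A :: "'a :: field mat"
  assumes "A \<in> carrier_mat n n" "upper_triangular A" "\<And>i. i < n \<Longrightarrow> A $$ (i, i) \<noteq> 0"
  obtains B where "B \<in> carrier_mat n n" "A * B = 1\<^sub>m n" "B * A = 1\<^sub>m n"
proof -
  have "det A \<noteq> 0"
    using assms by (auto simp: det_upper_triangular[OF assms(2,1)] diag_mat_def prod_list_zero_iff)
  from det_non_zero_imp_unit[OF assms(1) this, of "()"] show ?thesis
    using that unfolding Units_def ring_mat_def by auto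
qed

section \<open>Block antidiagonal matrices and their tridiagonal form\<close>

text \<open>Congruence by the block diagonal matrix with blocks \<open>P\<close> and
  \<open>Q\<close>.\<close>

lemma star_congruent_antidiagonal:
  fixes P :: "'a :: conjugatable_field mat"
  assumes P: "P \<in> carrier_mat n n" "P' \<in> carrier_mat n n" "P * P' = 1\<^sub>m n"
    and Q: "Q \<in> carrier_mat n n" "Q' \<in> carrier_mat n n" "Q * Q' = 1\<^sub>m n"
    and A: "A \<in> carrier_mat n n" and B: "B \<in> carrier_mat n n"
  shows "star_congruent (four_block_mat (0\<^sub>m n n) A B (0\<^sub>m n n))
    (four_block_mat (0\<^sub>m n n) (P * A * conj_transpose Q) (Q * B * conj_transpose P) (0\<^sub>m n n))"
proof (rule star_congruentI)
  let ?D = "\<lambda>P Q. four_block_mat P (0\<^sub>m n n) (0\<^sub>m n n) Q :: 'a mat"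
  show "?D P Q * ?D P' Q' = 1\<^sub>m (n + n)"
    using P Q by (subst mult_four_block_mat[of _ n n _ n _ n _ _ n _ n]) auto
  have adj: "conj_transpose (?D P Q) = ?D (conj_transpose P) (conj_transpose Q)"
    using P Q by (intro eq_matI) auto
  have PA: "P * A \<in> carrier_mat n n" and QB: "Q * B \<in> carrier_mat n n"
    using P Q A B by auto
  have "?D P Q * four_block_mat (0\<^sub>m n n) A B (0\<^sub>m n n)
      = four_block_mat (0\<^sub>m n n) (P * A) (Q * B) (0\<^sub>m n n)"
    using P Q A B by (subst mult_four_block_mat[of _ n n _ n _ n _ _ n _ n]) auto
  then show "?D P Q * four_block_mat (0\<^sub>m n n) A B (0\<^sub>m n n) * conj_transpose (?D P Q)
      = four_block_mat (0\<^sub>m n n) (P * A * conj_transpose Q) (Q * B * conj_transpose P) (0\<^sub>m n n)"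
    using P Q A B PA QB mult_carrier_mat[OF PA, of "conj_transpose Q" n]
      mult_carrier_mat[OF QB, of "conj_transpose P" n]
    unfolding adj
    by (simp add: mult_four_block_mat[of _ n n _ n _ n _ _ n _ n] del: assoc_mult_mat)
qed (use P Q A B in auto)

text \<open>\<open>T_mat\<close> over an arbitrary commutative ring, so that a complex
  \<open>\<mu>\<close> is allowed.\<close>

definition tridiag_mat :: "nat \<Rightarrow> 'a :: comm_ring_1 \<Rightarrow> 'a mat" where
  "tridiag_mat n \<mu> = mat n n (\<lambda>(i, j). if j = Suc i then 1 else if i = Suc j then \<mu> else 0)"

text \<open>Listing the even indices before the odd ones makes the tridiagonal matrix block antidiagonal.\<close>

lemma antidiagonal_tridiag:
  fixes \<mu> :: "'a :: conjugatable_field"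
  shows "star_congruent
    (four_block_mat (0\<^sub>m k k) (conj_transpose (bidiag_mat k 1 (conjugate \<mu>)))
      (bidiag_mat k \<mu> 1) (0\<^sub>m k k))
    (tridiag_mat (2 * k) \<mu>)"
proof (rule star_congruent_monomial[where n = "2 * k" and d = "\<lambda>_. 1"
      and \<sigma> = "\<lambda>i. i div 2 + (if even i then 0 else k)"])
  show "inj_on (\<lambda>i. i div 2 + (if even i then 0 else k)) {..<2 * k}"
    by (rule inj_onI) (auto split: if_splits elim!: evenE oddE)
  show "i div 2 + (if even i then 0 else k) < 2 * k" if "i < 2 * k" for i
    using that by auto
  fix i j assume ij: "i < 2 * k" "j < 2 * k"
  define p q where "p = i div 2" and "q = j div 2"
  have pq: "p < k" "q < k" using ij by (auto simp: p_def q_def)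
  \<comment> \<open>Even rows of the tridiagonal matrix come from the upper right block, odd rows
    from the lower left one. In each row one neighbour is a diagonal entry of the block and the
    other an off-diagonal entry.\<close>
  have "j = Suc i \<longleftrightarrow> even i \<and> odd j \<and> p = q \<or> odd i \<and> even j \<and> q = Suc p"
    "i = Suc j \<longleftrightarrow> odd i \<and> even j \<and> p = q \<or> even i \<and> odd j \<and> p = Suc q"
    unfolding p_def q_def
    by (cases "even i"; cases "even j"; auto elim!: evenE oddE
        simp: Suc_double_not_eq_double double_not_eq_Suc_double)+
  then have "tridiag_mat (2 * k) \<mu> $$ (i, j)
      = (if even i \<and> odd j \<and> p = q \<or> odd i \<and> even j \<and> q = Suc p then 1
         else if odd i \<and> even j \<and> p = q \<or> even i \<and> odd j \<and> p = Suc q then \<mu> else 0)"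
    using ij by (simp add: tridiag_mat_def)
  then show "tridiag_mat (2 * k) \<mu> $$ (i, j) = 1 * conjugate 1 *
      four_block_mat (0\<^sub>m k k) (conj_transpose (bidiag_mat k 1 (conjugate \<mu>)))
        (bidiag_mat k \<mu> 1) (0\<^sub>m k k)
      $$ (i div 2 + (if even i then 0 else k), j div 2 + (if even j then 0 else k))"
    unfolding p_def[symmetric] q_def[symmetric]
    by (cases "even i"; cases "even j") (use pq in \<open>simp_all add: bidiag_mat_def\<close>)
qed (auto simp: bidiag_mat_def tridiag_mat_def)

lemma H_tridiag:
  fixes \<mu> :: "'a :: conjugatable_field"
  assumes "\<mu> * conjugate \<mu> \<noteq> 1"
  shows "star_congruent
    (four_block_mat (0\<^sub>m k k) (1\<^sub>m k) (jordan_block k \<mu>) (0\<^sub>m k k)) (tridiag_mat (2 * k) \<mu>)"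
proof -
  define m where "m = conjugate \<mu>"
  define Y where "Y = shift_mat (\<mu> * m) m k"
  define R where "R = bidiag_mat k 1 m"
  define J where "J = bidiag_mat k \<mu> 1"
  have Y: "Y \<in> carrier_mat k k" and R: "R \<in> carrier_mat k k" and J: "J \<in> carrier_mat k k"
    by (auto simp: Y_def R_def J_def)
  \<comment> \<open>The diagonal entries are \<open>(1 - \<mu> * conjugate \<mu>) ^ i\<close>,
    nonzero by the hypothesis.\<close>
  have "upper_triangular Y" "\<And>i. i < k \<Longrightarrow> Y $$ (i, i) \<noteq> 0"
    using assms by (auto simp: Y_def shift_mat_def shift_coeff_lower shift_coeff_diag m_def)
  then obtain Z where Z: "Z \<in> carrier_mat k k" "Y * Z = 1\<^sub>m k" "Z * Y = 1\<^sub>m k"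
    using upper_triangular_invertible Y by blast
  have "upper_triangular R" "\<And>i. i < k \<Longrightarrow> R $$ (i, i) \<noteq> 0"
    by (auto simp: R_def bidiag_mat_def)
  then obtain R' where R': "R' \<in> carrier_mat k k" "R * R' = 1\<^sub>m k" "R' * R = 1\<^sub>m k"
    using upper_triangular_invertible R by blast
  \<comment> \<open>With \<open>Q = Z\<close>, the inverse of \<open>Y\<close>, the upper block
    becomes the conjugate transpose of \<open>Z * (Y * R) = R\<close>, and the lower block becomes
    \<open>Z * J * (Y * R) = Z * (Y * J) = J\<close>.\<close>
  define P where "P = conj_transpose (Y * R)"
  have YR: "Y * R \<in> carrier_mat k k" and RZ: "R' * Z \<in> carrier_mat k k" using Y R R' Z by auto
  have P: "P \<in> carrier_mat k k" using YR by (simp add: P_def)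
  have "(R' * Z) * (Y * R) = R' * (Z * Y) * R"
    using Y R R' Z(1) by (simp add: assoc_mult_mat[of _ k k _ k _ k])
  also have "\<dots> = 1\<^sub>m k"
    unfolding Z(3) right_mult_one_mat[OF R'(1)] by (rule R'(3))
  finally have "P * conj_transpose (R' * Z) = 1\<^sub>m k"
    unfolding P_def conj_transpose_mult[OF RZ YR, symmetric] by simp
  then have cong: "star_congruent (four_block_mat (0\<^sub>m k k) (1\<^sub>m k) J (0\<^sub>m k k))
      (four_block_mat (0\<^sub>m k k) (P * 1\<^sub>m k * conj_transpose Z) (Z * J * conj_transpose P) (0\<^sub>m k k))"
    using P RZ Z Y J by (intro star_congruent_antidiagonal) auto
  have "Z * (Y * R) = R"
    using Y R Z by (simp flip: assoc_mult_mat[of _ k k _ k _ k])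
  then have 1: "P * 1\<^sub>m k * conj_transpose Z = conj_transpose R"
    unfolding P_def right_mult_one_mat[OF P[unfolded P_def]]
    by (simp add: conj_transpose_mult[OF Z(1) YR, symmetric])
  have "Z * J * conj_transpose P = Z * (J * (Y * R))"
    unfolding P_def conj_transpose_idem by (rule assoc_mult_mat[OF Z(1) J YR])
  also have "\<dots> = Z * (Y * J)"
    unfolding Y_def R_def J_def shift_mat_intertwines ..
  also have "\<dots> = J"
    using Y J Z by (simp flip: assoc_mult_mat[of _ k k _ k _ k])
  finally have 2: "Z * J * conj_transpose P = J" .
  show ?thesis
    using star_congruent_trans[OF cong[unfolded 1 2]] antidiagonal_tridiag[of k \<mu>]
    unfolding R_def J_def m_def jordan_block_bidiag by blast
qed

section \<open>Realification of complex matrices\<close>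

text \<open>The entrywise embedding of the complex numbers into the real 2 by 2 matrices;
  conjugation of a number corresponds to transposition of its block.\<close>

definition realify :: "complex mat \<Rightarrow> real mat" where
  "realify A = block2_mat (dim_row A) (\<lambda>p q. C_mat (Re (A $$ (p, q))) (Im (A $$ (p, q))))"

text \<open>The size is written \<open>n * 2\<close> to fit \<open>div_mod_less\<close> and
  \<open>sum_div_mod\<close>.\<close>

lemma realify_carrier [simp]: "A \<in> carrier_mat n n \<Longrightarrow> realify A \<in> carrier_mat (n * 2) (n * 2)"
  by (auto simp: realify_def block2_mat_def)

lemma realify_index:
  assumes "A \<in> carrier_mat n n" "i < n * 2" "j < n * 2"
  shows "realify A $$ (i, j)
    = C_mat (Re (A $$ (i div 2, j div 2))) (Im (A $$ (i div 2, j div 2))) $$ (i mod 2, j mod 2)"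
  using assms by (auto simp: realify_def block2_mat_def)

lemma realify_one: "realify (1\<^sub>m n) = 1\<^sub>m (n * 2)"
proof (rule eq_matI)
  fix i j assume "i < dim_row (1\<^sub>m (n * 2) :: real mat)" "j < dim_col (1\<^sub>m (n * 2) :: real mat)"
  then have ij: "i < n * 2" "j < n * 2" by auto
  have "i = j \<longleftrightarrow> i div 2 = j div 2 \<and> i mod 2 = j mod 2"
    by (metis div_mult_mod_eq)
  then show "realify (1\<^sub>m n) $$ (i, j) = 1\<^sub>m (n * 2) $$ (i, j)"
    using ij div_mod_less[OF ij(1)] div_mod_less[OF ij(2)]
    by (auto simp: realify_index[of _ n] C_mat_index)
qed (auto simp: realify_def block2_mat_def)

text \<open>Blocks multiply and add like complex numbers, so the blockwise inner sum is the block of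
  the complex inner sum.\<close>

lemma realify_mult:
  assumes A: "A \<in> carrier_mat n n" and B: "B \<in> carrier_mat n n"
  shows "realify (A * B) = realify A * realify B"
proof (rule eq_matI)
  let ?C = "\<lambda>z. C_mat (Re z) (Im z)"
  fix i j assume "i < dim_row (realify A * realify B)" "j < dim_col (realify A * realify B)"
  then have ij: "i < n * 2" "j < n * 2" using A B by (auto simp: realify_def block2_mat_def)
  note lt = div_mod_less[OF ij(1)] div_mod_less[OF ij(2)]
  have AB: "A * B \<in> carrier_mat n n" using A B by simp
  have "(realify A * realify B) $$ (i, j)
      = (\<Sum>t<n * 2. realify A $$ (i, t) * realify B $$ (t, j))"
    using A B ij by (intro index_mult_mat_sum) auto
  also have "\<dots> = (\<Sum>t<n * 2. ?C (A $$ (i div 2, t div 2)) $$ (i mod 2, t mod 2)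
      * ?C (B $$ (t div 2, j div 2)) $$ (t mod 2, j mod 2))"
    using ij realify_index[OF A] realify_index[OF B] by (intro sum.cong) auto
  also have "\<dots> = (\<Sum>p<n. \<Sum>r<2. ?C (A $$ (i div 2, p)) $$ (i mod 2, r)
      * ?C (B $$ (p, j div 2)) $$ (r, j mod 2))"
    by (rule sum_div_mod)
  also have "\<dots> = (\<Sum>p<n. ?C (A $$ (i div 2, p) * B $$ (p, j div 2)) $$ (i mod 2, j mod 2))"
  proof (rule sum.cong)
    fix p
    show "(\<Sum>r<2. ?C (A $$ (i div 2, p)) $$ (i mod 2, r) * ?C (B $$ (p, j div 2)) $$ (r, j mod 2))
        = ?C (A $$ (i div 2, p) * B $$ (p, j div 2)) $$ (i mod 2, j mod 2)"
      using lt by (auto simp: C_mat_index lessThan_nat_numeral lessThan_Suc algebra_simps)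
  qed simp
  also have "\<dots> = ?C (\<Sum>p<n. A $$ (i div 2, p) * B $$ (p, j div 2)) $$ (i mod 2, j mod 2)"
    using lt by (simp add: C_mat_index sum_negf sum.distrib sum_subtractf)
  also have "\<dots> = realify (A * B) $$ (i, j)"
    unfolding realify_index[OF AB ij] index_mult_mat_sum[OF A B lt(1,3)] ..
  finally show "realify (A * B) $$ (i, j) = (realify A * realify B) $$ (i, j)" ..
qed (use A B in \<open>auto simp: realify_def block2_mat_def\<close>)

lemma realify_conj_transpose:
  assumes "A \<in> carrier_mat n n"
  shows "realify (conj_transpose A) = conj_transpose (realify A)"
proof (rule eq_matI)
  fix i j assume "i < dim_row (conj_transpose (realify A))" "j < dim_col (conj_transpose (realify A))"
  then have ij: "i < n * 2" "j < n * 2" using assms by (auto simp: realify_def block2_mat_def)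
  show "realify (conj_transpose A) $$ (i, j) = conj_transpose (realify A) $$ (i, j)"
    using div_mod_less[OF ij(1)] div_mod_less[OF ij(2)] carrier_matD[OF realify_carrier[OF assms]]
      assms ij
    by (auto simp: realify_index[of _ n] C_mat_index)
qed (use assms in \<open>auto simp: realify_def block2_mat_def\<close>)

lemma star_congruent_realify:
  assumes "star_congruent A B"
  shows "star_congruent (realify A) (realify B)"
proof -
  obtain n S R where *: "A \<in> carrier_mat n n" "B \<in> carrier_mat n n" "S \<in> carrier_mat n n"
    "R \<in> carrier_mat n n" "S * R = 1\<^sub>m n" "S * A * conj_transpose S = B"
    using assms unfolding star_congruent_def by blast
  show ?thesis
  proof (rule star_congruentI)
    show "realify S * realify R = 1\<^sub>m (n * 2)"
      using * by (simp flip: realify_mult add: realify_one)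
    have "S * A \<in> carrier_mat n n" "conj_transpose S \<in> carrier_mat n n" using * by auto
    then show "realify S * realify A * conj_transpose (realify S) = realify B"
      using * realify_mult realify_conj_transpose by metis
  qed (use * in auto)
qed

text \<open>The boundary between the four large blocks lies at the even index \<open>2 * k\<close>,
  so no 2 by 2 block straddles it, and the entry \<open>1\<close> becomes the block
  \<open>C(1, 0)\<close>, an identity.\<close>

lemma realify_H:
  "realify (four_block_mat (0\<^sub>m k k) (1\<^sub>m k) (jordan_block k (Complex a b)) (0\<^sub>m k k)) = H_hat_mat k a b"
  (is "realify ?H = _")
proof (rule eq_matI)
  have H: "?H \<in> carrier_mat (2 * k) (2 * k)" by (simp add: mult_2)
  fix i j assume "i < dim_row (H_hat_mat k a b)" "j < dim_col (H_hat_mat k a b)"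
  then have ij: "i < 2 * k * 2" "j < 2 * k * 2"
    by (auto simp: H_hat_mat_def C_block_mat_def block2_mat_def)
  define p r q s where "p = i div 2" "r = i mod 2" "q = j div 2" "s = j mod 2"
  note defs = this
  have pq: "p < 2 * k" "q < 2 * k" and rs: "r < 2" "s < 2" using ij by (auto simp: defs)
  have lt: "i < 2 * k \<longleftrightarrow> p < k" "j < 2 * k \<longleftrightarrow> q < k"
    unfolding defs by linarith+
  have shift: "(t - 2 * k) div 2 = t div 2 - k" "(t - 2 * k) mod 2 = t mod 2" if "2 * k \<le> t" for t
  proof -
    obtain u where "t = 2 * k + u" using \<open>2 * k \<le> t\<close> le_Suc_ex by blast
    then show "(t - 2 * k) div 2 = t div 2 - k" "(t - 2 * k) mod 2 = t mod 2" by auto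
  qed
  have i: "(i - 2 * k) div 2 = p - k" "(i - 2 * k) mod 2 = r" if "\<not> p < k"
    using that lt(1) shift[of i] by (auto simp: defs)
  \<comment> \<open>Locates the ones of the identity block in the upper right corner, in terms of
    block index and position within the block.\<close>
  have j: "i = j - 2 * k \<longleftrightarrow> p = q - k \<and> r = s" if "\<not> q < k"
  proof -
    have "i = j - 2 * k \<longleftrightarrow> i div 2 = (j - 2 * k) div 2 \<and> i mod 2 = (j - 2 * k) mod 2"
      by (metis div_mult_mod_eq)
    then show ?thesis using that lt(2) shift[of j] by (simp add: defs)
  qed
  have "realify ?H $$ (i, j) = C_mat (Re (?H $$ (p, q))) (Im (?H $$ (p, q))) $$ (r, s)"
    unfolding realify_index[OF H ij] defs ..
  also have "\<dots> = H_hat_mat k a b $$ (i, j)"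
  proof (cases "p < k"; cases "q < k")
    assume "p < k" "q < k"
    then show ?thesis
      using lt rs by (simp add: H_hat_mat_def C_block_mat_def block2_mat_def C_mat_index)
  next
    assume "p < k" "\<not> q < k"
    then show ?thesis
      using lt rs pq ij j by (simp add: H_hat_mat_def C_block_mat_def block2_mat_def C_mat_index)
  next
    assume "\<not> p < k" "q < k"
    moreover have "i - 2 * k < 2 * k" using ij by simp
    ultimately show ?thesis
      using lt rs pq ij i
      by (auto simp: H_hat_mat_def C_block_mat_def block2_mat_def C_mat_index defs(3,4)[symmetric])
  next
    assume "\<not> p < k" "\<not> q < k"
    then show ?thesis
      using lt rs pq ij by (simp add: H_hat_mat_def C_block_mat_def block2_mat_def C_mat_index)
  qed
  finally show "realify ?H $$ (i, j) = H_hat_mat k a b $$ (i, j)" .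
qed (auto simp: realify_def H_hat_mat_def C_block_mat_def block2_mat_def)

lemma realify_tridiag: "realify (tridiag_mat n (Complex a b)) = T_hat_mat n a b"
proof (rule eq_matI)
  fix i j assume "i < dim_row (T_hat_mat n a b)" "j < dim_col (T_hat_mat n a b)"
  then have ij: "i < n * 2" "j < n * 2"
    by (auto simp: T_hat_mat_def block2_mat_def)
  then show "realify (tridiag_mat n (Complex a b)) $$ (i, j) = T_hat_mat n a b $$ (i, j)"
    using div_mod_less[OF ij(1)] div_mod_less[OF ij(2)]
    by (auto simp: realify_index[of _ n] T_hat_mat_def block2_mat_def tridiag_mat_def C_mat_index)
qed (auto simp: realify_def T_hat_mat_def tridiag_mat_def block2_mat_def)

section \<open>The five congruences from the general results\<close>

theorem theorem6p1:
  fixes k :: nat and \<epsilon> :: real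
  assumes "k \<ge> 1"
    and "\<epsilon> = (if k mod 4 = 1 \<or> k mod 4 = 2 then 1 else - 1)"
  shows
    "real_congruent (jordan_block k 0) (T_mat k 0)
     \<and> (real_congruent (Gamma_mat k \<otimes>\<^sub>K mat1 1) (Gamma_tilde_mat k \<otimes>\<^sub>K mat1 \<epsilon>)
        \<and> real_congruent (Gamma_mat k \<otimes>\<^sub>K mat1 (- 1)) (Gamma_tilde_mat k \<otimes>\<^sub>K mat1 (- \<epsilon>)))
     \<and> (\<forall>a b :: real. a\<^sup>2 + b\<^sup>2 = 1 \<and> b > 0 \<longrightarrow>
          real_congruent (Gamma_mat k \<otimes>\<^sub>K C_mat a b) (Gamma_tilde_mat k \<otimes>\<^sub>K C_mat (\<epsilon> * a) b))
     \<and> (\<forall>a :: real. 0 < \<bar>a\<bar> \<and> \<bar>a\<bar> < 1 \<longrightarrow>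
          real_congruent (H_mat k a) (T_mat (2 * k) a))
     \<and> (\<forall>a b :: real. a\<^sup>2 + b\<^sup>2 < 1 \<and> b > 0 \<longrightarrow>
          real_congruent (H_hat_mat k a b) (T_hat_mat (2 * k) a b))"
proof (intro conjI allI impI)
  have \<epsilon>: "\<epsilon> = 1 \<or> \<epsilon> = - 1" using assms(2) by auto
  have "jordan_block k 0 = T_mat k 0"
    by (rule eq_matI) (auto simp: T_mat_def)
  then show "real_congruent (jordan_block k 0) (T_mat k 0)"
    using star_congruent_imp_real_congruent star_congruent_refl jordan_block_carrier by metis
  \<comment> \<open>For 1 by 1 matrices the two sides coincide, since
    \<open>\<epsilon> * \<epsilon> = 1\<close>.\<close>
  have "star_congruent (mat1 x) (\<epsilon> \<cdot>\<^sub>m mat1 (\<epsilon> * x))" for x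
  proof -
    have "\<epsilon> \<cdot>\<^sub>m mat1 (\<epsilon> * x) = mat1 x" "mat1 x \<in> carrier_mat 1 1"
      using \<epsilon> by (auto simp: mat1_def mat_of_rows_list_def)
    then show ?thesis using star_congruent_refl by metis
  qed
  from Gamma_kronecker[OF assms this[of 1]] Gamma_kronecker[OF assms this[of "- 1"]]
  show "real_congruent (Gamma_mat k \<otimes>\<^sub>K mat1 1) (Gamma_tilde_mat k \<otimes>\<^sub>K mat1 \<epsilon>)"
    and "real_congruent (Gamma_mat k \<otimes>\<^sub>K mat1 (- 1)) (Gamma_tilde_mat k \<otimes>\<^sub>K mat1 (- \<epsilon>))"
    by simp_all
  show "real_congruent (Gamma_mat k \<otimes>\<^sub>K C_mat a b) (Gamma_tilde_mat k \<otimes>\<^sub>K C_mat (\<epsilon> * a) b)" for a b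
    by (rule Gamma_kronecker[OF assms C_mat_star_congruent[OF \<epsilon>]])
next
  fix a :: real assume "0 < \<bar>a\<bar> \<and> \<bar>a\<bar> < 1"
  then have "a * conjugate a \<noteq> 1"
    using abs_square_less_1[of a] by (simp add: power2_eq_square)
  from H_tridiag[OF this] show "real_congruent (H_mat k a) (T_mat (2 * k) a)"
    unfolding H_mat_def T_mat_def tridiag_mat_def by (rule star_congruent_imp_real_congruent)
next
  fix a b :: real assume "a\<^sup>2 + b\<^sup>2 < 1 \<and> b > 0"
  \<comment> \<open>The product has real part \<open>a\<^sup>2 + b\<^sup>2\<close>, which is less
    than 1.\<close>
  then have "Complex a b * conjugate (Complex a b) \<noteq> 1"
    by (auto simp: complex_eq_iff power2_eq_square)
  from star_congruent_realify[OF H_tridiag[OF this]]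
  show "real_congruent (H_hat_mat k a b) (T_hat_mat (2 * k) a b)"
    unfolding realify_H realify_tridiag by (rule star_congruent_imp_real_congruent)
qed

end
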